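(* Let $\mathbb{F}$ be a field of prime characteristic $p$ and let $I$ be an $\mathbb{F}$-vector space of dimension $2p$ with basis $\{v_1,\ldots,v_{2p}\}$. Define endomorphisms $x,y,z$ of $I$ by $$x:\ v_i\mapsto v_{i+1}\ (1\leq i\leq p-1),\quad v_p\mapsto v_1,\quad v_{p+i}\mapsto v_{p+i+1}\ (1\leq i\leq p-1),\quad v_{2p}\mapsto v_{p+1};$$ $$y:\ v_i\mapsto 0\ (1\leq i\leq p),\quad v_{p+1}\mapsto 0,\quad v_{p+i}\mapsto (i-1)v_{i}\ (2\leq i\leq p);$$ $$z:\ v_i\mapsto 0\ (1\leq i\leq p),\quad v_{p+i}\mapsto v_{i+1}\ (1\leq i\leq p-1),\quad v_{2p}\mapsto v_1.$$ Let $H=\langle x,y,z\rangle$ be the Lie subalgebra of $\mathfrak{gl}(I)$ generated by $x,y,z$ (a Heisenberg Lie algebra), and let $L=H\ltimes I$ be the semidirect sum of $H$ and the abelian Lie algebra $I$. Then $L$ is solvable of derived length $3$, but not nilpotent. If $|\mathbb{F}|\geq p^2$, then $L$ admits a non-singular derivation.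
   Context: $\mathfrak{gl}(I)$ is the Lie algebra of endomorphisms of $I$ with bracket $[a,b]=ab-ba$. The Heisenberg Lie algebra is the 3-dimensional Lie algebra with a basis $x,y,z$ such that $[x,y]=z$ and $[x,z]=[y,z]=0$, up to isomorphism. The semidirect sum $H\ltimes I$ is the vector space $H\oplus I$ with bracket $[(h_1,v_1),(h_2,v_2)]=([h_1,h_2],\,h_1(v_2)-h_2(v_1))$. The derived length of $L$ is the smallest $n$ with $L^{(n)}=0$, where $L^{(0)}=L$ and $L^{(i)}=[L^{(i-1)},L^{(i-1)}]$. A derivation is non-singular if it is an invertible linear map. *)

theory Defs
  imports
    Complex_Main
    "HOL-Library.Function_Algebras"
    "HOL-Library.Product_Plus"
    "HOL-Computational_Algebra.Primes"
begin

text \<open>The carrier of a Lie algebra is a subspace of an ambient vector space, so that Lie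
  subalgebras, and algebras whose elements are endomorphisms, do not need types of their own.\<close>

record ('f, 'a) lie =
  lie_carrier :: "'a set"
  lie_scale :: "'f \<Rightarrow> 'a \<Rightarrow> 'a"
  lie_bracket :: "'a \<Rightarrow> 'a \<Rightarrow> 'a"

locale lie_algebra = vector_space "lie_scale L"
  for L :: "('f::field, 'a::ab_group_add) lie" +
  assumes subspace_carrier: "subspace (lie_carrier L)"
    and bracket_closed:
      "\<lbrakk>a \<in> lie_carrier L; b \<in> lie_carrier L\<rbrakk> \<Longrightarrow> lie_bracket L a b \<in> lie_carrier L"
    and bracket_add_left:
      "\<lbrakk>a \<in> lie_carrier L; b \<in> lie_carrier L; c \<in> lie_carrier L\<rbrakk> \<Longrightarrow>
        lie_bracket L (a + b) c = lie_bracket L a c + lie_bracket L b c"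
    and bracket_add_right:
      "\<lbrakk>a \<in> lie_carrier L; b \<in> lie_carrier L; c \<in> lie_carrier L\<rbrakk> \<Longrightarrow>
        lie_bracket L a (b + c) = lie_bracket L a b + lie_bracket L a c"
    and bracket_scale_left:
      "\<lbrakk>a \<in> lie_carrier L; b \<in> lie_carrier L\<rbrakk> \<Longrightarrow>
        lie_bracket L (lie_scale L k a) b = lie_scale L k (lie_bracket L a b)"
    and bracket_scale_right:
      "\<lbrakk>a \<in> lie_carrier L; b \<in> lie_carrier L\<rbrakk> \<Longrightarrow>
        lie_bracket L a (lie_scale L k b) = lie_scale L k (lie_bracket L a b)"
    and bracket_self: "a \<in> lie_carrier L \<Longrightarrow> lie_bracket L a a = 0"
    and jacobi:
      "\<lbrakk>a \<in> lie_carrier L; b \<in> lie_carrier L; c \<in> lie_carrier L\<rbrakk> \<Longrightarrow>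
        lie_bracket L a (lie_bracket L b c) + lie_bracket L b (lie_bracket L c a)
          + lie_bracket L c (lie_bracket L a b) = 0"

definition lie_subalgebra :: "('f::field, 'a::ab_group_add) lie \<Rightarrow> 'a set \<Rightarrow> bool" where
  "lie_subalgebra L K \<longleftrightarrow>
     module.subspace (lie_scale L) K \<and> K \<subseteq> lie_carrier L \<and>
     (\<forall>a\<in>K. \<forall>b\<in>K. lie_bracket L a b \<in> K)"

definition generated_subalgebra ::
  "('f::field, 'a::ab_group_add) lie \<Rightarrow> 'a set \<Rightarrow> ('f, 'a) lie" where
  "generated_subalgebra L S = L\<lparr>lie_carrier := lie_subalgebra L hull S\<rparr>"

definition gl :: "('f::field \<Rightarrow> 'v::ab_group_add \<Rightarrow> 'v) \<Rightarrow> ('f, 'v \<Rightarrow> 'v) lie" where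
  "gl scale =
     \<lparr>lie_carrier = {f. Vector_Spaces.linear scale scale f},
      lie_scale = (\<lambda>k f v. scale k (f v)),
      lie_bracket = (\<lambda>f g. (f \<circ> g) - (g \<circ> f))\<rparr>"

text \<open>The semidirect sum of a subalgebra \<open>H\<close> of \<open>gl scale\<close> with the space (all of the type
  \<open>'v\<close>) on which it acts, the latter being an abelian ideal.\<close>

definition semidirect_sum ::
  "('f::field, 'v \<Rightarrow> 'v) lie \<Rightarrow> ('f \<Rightarrow> 'v::ab_group_add \<Rightarrow> 'v) \<Rightarrow> ('f, ('v \<Rightarrow> 'v) \<times> 'v) lie" where
  "semidirect_sum H scale =
     \<lparr>lie_carrier = lie_carrier H \<times> UNIV,
      lie_scale = (\<lambda>k (h, v). (lie_scale H k h, scale k v)),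
      lie_bracket = (\<lambda>(h1, v1) (h2, v2). (lie_bracket H h1 h2, h1 v2 - h2 v1))\<rparr>"

definition heisenberg_lie_algebra :: "('f::field, 'a::ab_group_add) lie \<Rightarrow> bool" where
  "heisenberg_lie_algebra L \<longleftrightarrow>
     lie_algebra L \<and>
     (\<exists>a b c. distinct [a, b, c] \<and>
        \<not> module.dependent (lie_scale L) {a, b, c} \<and>
        module.span (lie_scale L) {a, b, c} = lie_carrier L \<and>
        lie_bracket L a b = c \<and> lie_bracket L a c = 0 \<and> lie_bracket L b c = 0)"

definition bracket_span ::
  "('f::field, 'a::ab_group_add) lie \<Rightarrow> 'a set \<Rightarrow> 'a set \<Rightarrow> 'a set" where
  "bracket_span L A B = module.span (lie_scale L) {lie_bracket L a b | a b. a \<in> A \<and> b \<in> B}"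

primrec derived_series :: "('f::field, 'a::ab_group_add) lie \<Rightarrow> nat \<Rightarrow> 'a set" where
  "derived_series L 0 = lie_carrier L"
| "derived_series L (Suc n) = bracket_span L (derived_series L n) (derived_series L n)"

primrec lower_central_series :: "('f::field, 'a::ab_group_add) lie \<Rightarrow> nat \<Rightarrow> 'a set" where
  "lower_central_series L 0 = lie_carrier L"
| "lower_central_series L (Suc n) = bracket_span L (lie_carrier L) (lower_central_series L n)"

definition lie_solvable :: "('f::field, 'a::ab_group_add) lie \<Rightarrow> bool" where
  "lie_solvable L \<longleftrightarrow> (\<exists>n. derived_series L n = {0})"

text \<open>Only meaningful for solvable Lie algebras.\<close>

definition derived_length :: "('f::field, 'a::ab_group_add) lie \<Rightarrow> nat" where
  "derived_length L = (LEAST n. derived_series L n = {0})"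

definition lie_nilpotent :: "('f::field, 'a::ab_group_add) lie \<Rightarrow> bool" where
  "lie_nilpotent L \<longleftrightarrow> (\<exists>n. lower_central_series L n = {0})"

text \<open>Only the restriction of \<open>D\<close> to the carrier matters; its values elsewhere are irrelevant.\<close>

definition lie_derivation ::
  "('f::field, 'a::ab_group_add) lie \<Rightarrow> ('a \<Rightarrow> 'a) \<Rightarrow> bool" where
  "lie_derivation L D \<longleftrightarrow>
     (\<forall>a\<in>lie_carrier L. D a \<in> lie_carrier L) \<and>
     (\<forall>a\<in>lie_carrier L. \<forall>b\<in>lie_carrier L. D (a + b) = D a + D b) \<and>
     (\<forall>k. \<forall>a\<in>lie_carrier L. D (lie_scale L k a) = lie_scale L k (D a)) \<and>
     (\<forall>a\<in>lie_carrier L. \<forall>b\<in>lie_carrier L.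
        D (lie_bracket L a b) = lie_bracket L (D a) b + lie_bracket L a (D b))"

definition nonsingular_derivation ::
  "('f::field, 'a::ab_group_add) lie \<Rightarrow> ('a \<Rightarrow> 'a) \<Rightarrow> bool" where
  "nonsingular_derivation L D \<longleftrightarrow>
     lie_derivation L D \<and> bij_betw D (lie_carrier L) (lie_carrier L)"


section \<open>The constructions above yield Lie algebras\<close>

lemma (in lie_algebra) lie_algebra_subalgebra:
  assumes "lie_subalgebra L K"
  shows "lie_algebra (L\<lparr>lie_carrier := K\<rparr>)"
proof -
  have "K \<subseteq> lie_carrier L" "subspace K"
    and "\<And>a b. a \<in> K \<Longrightarrow> b \<in> K \<Longrightarrow> lie_bracket L a b \<in> K"
    using assms by (auto simp: lie_subalgebra_def)
  then show ?thesis
    by unfold_locales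
      (auto simp: subset_iff scale_right_distrib scale_left_distrib bracket_add_left
        bracket_add_right bracket_scale_left bracket_scale_right bracket_self jacobi)
qed

lemma (in lie_algebra) lie_subalgebra_carrier: "lie_subalgebra L (lie_carrier L)"
  by (auto simp: lie_subalgebra_def subspace_carrier bracket_closed)

lemma (in lie_algebra) lie_subalgebra_hull:
  assumes "S \<subseteq> lie_carrier L"
  shows "lie_subalgebra L (lie_subalgebra L hull S)"
proof -
  have "lie_subalgebra L hull S \<subseteq> lie_carrier L"
    using assms lie_subalgebra_carrier by (rule hull_minimal)
  then show ?thesis
    by (auto simp: lie_subalgebra_def hull_def subspace_def)
qed

lemma (in lie_algebra) lie_algebra_generated:
  "S \<subseteq> lie_carrier L \<Longrightarrow> lie_algebra (generated_subalgebra L S)"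
  unfolding generated_subalgebra_def
  by (rule lie_algebra_subalgebra) (rule lie_subalgebra_hull)

lemma vector_space_fun:
  assumes "vector_space (scale :: 'f::field \<Rightarrow> 'v::ab_group_add \<Rightarrow> 'v)"
  shows "vector_space (\<lambda>k (f :: 'b \<Rightarrow> 'v) v. scale k (f v))"
proof -
  interpret vector_space scale by fact
  show ?thesis
    by unfold_locales (auto simp: fun_eq_iff scale_right_distrib scale_left_distrib)
qed

lemma lie_algebra_gl:
  assumes "vector_space (scale :: 'f::field \<Rightarrow> 'v::ab_group_add \<Rightarrow> 'v)"
  shows "lie_algebra (gl scale)"
proof -
  interpret vector_space scale by fact
  interpret vs: vector_space_pair scale scale ..
  interpret F: vector_space "\<lambda>k (f :: 'v \<Rightarrow> 'v) v. scale k (f v)"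
    by (rule vector_space_fun) fact
  have lin: "Vector_Spaces.linear scale scale f \<longleftrightarrow>
      (\<forall>a b. f (a + b) = f a + f b) \<and> (\<forall>k a. f (scale k a) = scale k (f a))" for f
    using vector_space_axioms
    by (auto simp: linear_iff_module_hom module_hom_iff module_iff_vector_space)
  have diff: "f (a - b) = f a - f b" if "Vector_Spaces.linear scale scale f" for f a b
    using that by (rule vs.linear_diff)
  show ?thesis
    by unfold_locales
      (auto simp: gl_def F.subspace_def lin fun_eq_iff scale_right_distrib scale_left_distrib
        scale_right_diff_distrib diff[unfolded lin] scale_left_commute mult.commute)
qed

lemma lie_algebra_semidirect_sum:
  assumes "vector_space (scale :: 'f::field \<Rightarrow> 'v::ab_group_add \<Rightarrow> 'v)"
    and "lie_subalgebra (gl scale) K"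
  shows "lie_algebra (semidirect_sum ((gl scale)\<lparr>lie_carrier := K\<rparr>) scale)"
proof -
  interpret vector_space scale by fact
  interpret vs: vector_space_pair scale scale ..
  interpret G: lie_algebra "gl scale" by (rule lie_algebra_gl) fact
  let ?H = "(gl scale)\<lparr>lie_carrier := K\<rparr>"
  interpret H: lie_algebra ?H by (rule G.lie_algebra_subalgebra) fact
  let ?S = "lie_scale (semidirect_sum ?H scale)"
  interpret S: vector_space ?S
    by unfold_locales
      (auto simp: semidirect_sum_def scale_right_distrib scale_left_distrib
        G.scale_right_distrib G.scale_left_distrib)
  have lin: "Vector_Spaces.linear scale scale f" if "f \<in> K" for f
    using that assms(2) by (auto simp: lie_subalgebra_def gl_def)
  have "S.subspace (lie_carrier (semidirect_sum ?H scale))"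
    using H.subspace_carrier
    unfolding S.subspace_def H.subspace_def
    by (auto simp: semidirect_sum_def zero_prod_def)
  moreover have bracket: "lie_bracket (gl scale) f g v = f (g v) - g (f v)" for f g v
    by (simp add: gl_def)
  moreover have scl: "lie_scale (gl scale) k f v = scale k (f v)" for k f v
    by (simp add: gl_def)
  ultimately show ?thesis
    using H.bracket_closed H.bracket_add_left H.bracket_add_right
      H.bracket_scale_left H.bracket_scale_right H.bracket_self H.jacobi
    by unfold_locales
      (auto simp: semidirect_sum_def zero_prod_def
        bracket scl lin[THEN vs.linear_add] lin[THEN vs.linear_diff] lin[THEN vs.linear_scale]
        scale_right_diff_distrib)
qed

end

theory Submission
  imports Defs
begin

text \<open>Split the basis into two cyclic halves \<open>u j\<close>, \<open>w j\<close> indexed modulo \<open>p\<close>: then \<open>x\<close> shifts both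
  halves, \<open>y\<close> sends \<open>w j\<close> to \<open>j u j\<close>, and \<open>z\<close> sends \<open>w j\<close> to \<open>u (j + 1)\<close>, so that \<open>[y, x] = z\<close>.
  Since \<open>x\<close> permutes the \<open>u j\<close>, their span survives in the lower central series.

  The derivation is \<open>(h, i) \<mapsto> ([d, h], d i)\<close> with \<open>d = e + b x\<close>, where \<open>e\<close> is diagonal with eigenvalue
  \<open>j\<close> on \<open>u j\<close> and \<open>j - b\<close> on \<open>w j\<close>, which is well defined in characteristic \<open>p\<close>. The operator \<open>d\<close>
  normalises \<open>H\<close>, acting on it with eigenvalues \<open>1\<close>, \<open>b\<close>, \<open>1 + b\<close>. For odd \<open>p\<close> one takes \<open>b = 1\<close>, and
  any \<open>b\<close> other than \<open>0\<close> and \<open>1\<close> for \<open>p = 2\<close>. The off-diagonal term \<open>b x\<close> is essential over the field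
  with four elements, where no diagonal choice of \<open>d\<close> is non-singular.\<close>

section \<open>Bracket spans and the derived series\<close>

lemma (in lie_algebra) bracket_span_subset:
  assumes "subspace C" and "\<And>a b. a \<in> A \<Longrightarrow> b \<in> B \<Longrightarrow> lie_bracket L a b \<in> C"
  shows "bracket_span L A B \<subseteq> C"
  unfolding bracket_span_def using assms by (intro span_minimal) auto

lemma (in lie_algebra) bracket_in_bracket_span:
  "a \<in> A \<Longrightarrow> b \<in> B \<Longrightarrow> lie_bracket L a b \<in> bracket_span L A B"
  unfolding bracket_span_def by (intro span_base) auto

text \<open>Once zero, the series stays zero, so a nonzero second term bounds the derived length
  below by 3.\<close>

lemma (in lie_algebra) derived_series_zero_mono:
  assumes "derived_series L m = {0}" and "m \<le> n"
  shows "derived_series L n = {0}"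
  using assms(2)
proof (induction rule: dec_induct)
  case (step k)
  have "{lie_bracket L a b | a b. a \<in> {0} \<and> b \<in> {0}} = {0}"
    using bracket_self[of 0] subspace_0[OF subspace_carrier] by auto
  then show ?case by (simp only: derived_series.simps step.IH bracket_span_def) simp
qed (fact assms(1))

section \<open>The module in cyclic coordinates\<close>

locale heisenberg_module = vector_space scale
  for scale :: "'f::field \<Rightarrow> 'v::ab_group_add \<Rightarrow> 'v" (infixr "*s" 75)
    and p :: nat and v :: "nat \<Rightarrow> 'v" and x y z :: "'v \<Rightarrow> 'v" +
  assumes prime_p: "prime p" and CHAR_p: "CHAR('f) = p"
    and inj_v: "inj_on v {1..2 * p}"
    and independent_v: "independent (v ` {1..2 * p})"
    and span_v: "span (v ` {1..2 * p}) = UNIV"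
    and linear_x: "Vector_Spaces.linear scale scale x"
    and x_low: "\<And>i. i \<in> {1..p - 1} \<Longrightarrow> x (v i) = v (i + 1)"
    and x_p: "x (v p) = v 1"
    and x_high: "\<And>i. i \<in> {1..p - 1} \<Longrightarrow> x (v (p + i)) = v (p + i + 1)"
    and x_2p: "x (v (2 * p)) = v (p + 1)"
    and linear_y: "Vector_Spaces.linear scale scale y"
    and y_low: "\<And>i. i \<in> {1..p} \<Longrightarrow> y (v i) = 0"
    and y_Suc_p: "y (v (p + 1)) = 0"
    and y_high: "\<And>i. i \<in> {2..p} \<Longrightarrow> y (v (p + i)) = scale (of_nat (i - 1)) (v i)"
    and linear_z: "Vector_Spaces.linear scale scale z"
    and z_low: "\<And>i. i \<in> {1..p} \<Longrightarrow> z (v i) = 0"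
    and z_high: "\<And>i. i \<in> {1..p - 1} \<Longrightarrow> z (v (p + i)) = v (i + 1)"
    and z_2p: "z (v (2 * p)) = v 1"
begin

sublocale vsp: vector_space_pair scale scale ..

sublocale finite_dimensional_vector_space scale "v ` {1..2 * p}"
  by unfold_locales (use independent_v span_v in blast)+

text \<open>Reducing the index modulo \<open>p\<close> lets one formula cover the wrap-around;
  \<open>Suc\<close> is there because \<open>v\<close> starts at 1.\<close>

definition u :: "nat \<Rightarrow> 'v" where "u j = v (Suc (j mod p))"
definition w :: "nat \<Rightarrow> 'v" where "w j = v (p + Suc (j mod p))"

lemma p_gt_1: "1 < p"
  using prime_p by (rule prime_gt_1_nat)

lemma p_mod: "j mod p < p"
  using p_gt_1 by simp

text \<open>In characteristic \<open>p\<close> a scalar \<open>of_nat j\<close> depends only on the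
  residue of \<open>j\<close>, so it is a legitimate coefficient on a cycle.\<close>

lemma of_nat_mod_p: "of_nat (j mod p) = (of_nat j :: 'f)"
proof -
  have "(of_nat j :: 'f) = of_nat (j div p) * of_nat p + of_nat (j mod p)"
    by (metis div_mult_mod_eq of_nat_add of_nat_mult)
  moreover have "(of_nat p :: 'f) = 0"
    using CHAR_p of_nat_CHAR by metis
  ultimately show ?thesis by simp
qed

lemma w_p [simp]: "w p = w 0"
  by (simp add: w_def)

lemma v_cases:
  assumes "i \<in> {1..2 * p}"
  obtains j where "v i = u j" | j where "v i = w j"
proof (cases "i \<le> p")
  case True
  then show ?thesis using assms that(1)[of "i - 1"] by (auto simp: u_def)
next
  case False
  then show ?thesis using assms that(2)[of "i - p - 1"] by (auto simp: w_def Suc_diff_Suc)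
qed

lemma span_uw: "span (range u \<union> range w) = UNIV"
proof -
  have "v ` {1..2 * p} \<subseteq> range u \<union> range w"
    by (blast elim: v_cases)
  then show ?thesis using span_mono span_v by blast
qed

lemma linear_ext:
  assumes "Vector_Spaces.linear scale scale f" and "Vector_Spaces.linear scale scale g"
    and "\<And>j. f (u j) = g (u j)" and "\<And>j. f (w j) = g (w j)"
  shows "f = g"
proof
  fix a show "f a = g a"
    by (rule vsp.linear_eq_on[OF assms(1,2), of _ "range u \<union> range w"])
      (auto simp: span_uw assms(3,4))
qed

lemma x_u [simp]: "x (u j) = u (Suc j)"
  using x_low[of "Suc (j mod p)"] x_p p_mod[of j]
  by (cases "Suc (j mod p) = p") (auto simp: u_def mod_Suc)

lemma x_w [simp]: "x (w j) = w (Suc j)"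
  using x_high[of "Suc (j mod p)"] x_2p p_mod[of j]
  by (cases "Suc (j mod p) = p") (auto simp: w_def mod_Suc mult_2)

lemma y_u [simp]: "y (u j) = 0"
  using p_mod[of j] by (simp add: u_def y_low)

lemma y_w [simp]: "y (w j) = of_nat j *s u j"
proof -
  have "y (w j) = of_nat (j mod p) *s u j"
    using y_high[of "Suc (j mod p)"] y_Suc_p p_mod[of j]
    by (cases "j mod p = 0") (auto simp: u_def w_def)
  then show ?thesis by (simp only: of_nat_mod_p)
qed

lemma z_u [simp]: "z (u j) = 0"
  using p_mod[of j] by (simp add: u_def z_low)

lemma z_w [simp]: "z (w j) = u (Suc j)"
  using z_high[of "Suc (j mod p)"] z_2p p_mod[of j]
  by (cases "Suc (j mod p) = p") (auto simp: u_def w_def mod_Suc mult_2)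

lemma u_nonzero: "u j \<noteq> 0"
proof -
  have "u j \<in> v ` {1..2 * p}" using p_mod[of j] by (auto simp: u_def)
  then show ?thesis using independent_v dependent_zero by metis
qed

lemmas linear_xyz_simps [simp] =
  linear_x[THEN vsp.linear_add] linear_x[THEN vsp.linear_scale] linear_x[THEN vsp.linear_0]
  linear_x[THEN vsp.linear_diff]
  linear_y[THEN vsp.linear_add] linear_y[THEN vsp.linear_scale] linear_y[THEN vsp.linear_0]
  linear_y[THEN vsp.linear_diff]
  linear_z[THEN vsp.linear_add] linear_z[THEN vsp.linear_scale] linear_z[THEN vsp.linear_0]
  linear_z[THEN vsp.linear_diff]

section \<open>The Heisenberg algebra in coordinates\<close>

definition comb :: "'f \<Rightarrow> 'f \<Rightarrow> 'f \<Rightarrow> 'v \<Rightarrow> 'v" where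
  "comb a b c = (\<lambda>i. a *s x i + b *s y i + c *s z i)"

lemma linear_comb: "Vector_Spaces.linear scale scale (comb a b c)"
  unfolding comb_def
  by (intro vsp.linear_compose_add vsp.linear_compose_scale_right linear_x linear_y linear_z)

lemma comb_gens: "comb 1 0 0 = x" "comb 0 1 0 = y" "comb 0 0 1 = z"
  by (auto simp: comb_def)

lemma comb_zero [simp]: "comb 0 0 0 = 0"
  by (auto simp: comb_def)

lemma comb_add: "comb a b c + comb a' b' c' = comb (a + a') (b + b') (c + c')"
  by (auto simp: comb_def fun_eq_iff scale_left_distrib)

lemma comb_scale: "(\<lambda>i. k *s comb a b c i) = comb (k * a) (k * b) (k * c)"
  by (auto simp: comb_def fun_eq_iff scale_right_distrib)

lemma comb_eq_0_iff: "comb a b c = 0 \<longleftrightarrow> a = 0 \<and> b = 0 \<and> c = 0"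
proof
  assume 0: "comb a b c = 0"
  then have "comb a b c i = 0" for i by simp
  \<comment> \<open>The values are \<open>a *s u 1\<close>, then \<open>a *s w 1 + c *s u 1\<close>
    since \<open>y\<close> kills \<open>w 0\<close>, and finally \<open>w 1\<close> isolates
    \<open>b\<close>.\<close>
  from this[of "u 0"] this[of "w 0"] this[of "w 1"]
  show "a = 0 \<and> b = 0 \<and> c = 0" by (auto simp: comb_def u_nonzero)
qed simp

lemma comb_eq_iff: "comb a b c = comb a' b' c' \<longleftrightarrow> a = a' \<and> b = b' \<and> c = c'"
proof -
  have "comb a b c - comb a' b' c' = comb (a - a') (b - b') (c - c')"
    by (auto simp: comb_def fun_eq_iff algebra_simps)
  then show ?thesis using comb_eq_0_iff[of "a - a'" "b - b'" "c - c'"] by auto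
qed

lemma linearI:
  assumes "\<And>a b. f (a + b) = f a + f b" and "\<And>k a. f (k *s a) = k *s f a"
  shows "Vector_Spaces.linear scale scale f"
  using assms vector_space_axioms
  by (auto simp: linear_iff_module_hom module_hom_iff module_iff_vector_space)

text \<open>It suffices to check on \<open>u j\<close> and \<open>w j\<close>. Both \<open>y\<close>
  and \<open>z\<close> send the \<open>w\<close> half into the \<open>u\<close> half, which they
  kill, so their products vanish; the last relation holds because
  \<open>(j + 1) - j = 1\<close>.\<close>

lemma products:
  "y (y i) = 0" "y (z i) = 0" "z (y i) = 0" "z (z i) = 0" "z (x i) = x (z i)"
  "y (x i) = x (y i) + z i"
  by (rule fun_cong[of _ _ i], rule linear_ext;
      (rule linearI)?; simp add: algebra_simps)+

lemma bracket_comb: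
  "lie_bracket (gl scale) (comb a b c) (comb a' b' c') = comb 0 0 (b * a' - a * b')"
  by (auto simp: gl_def comb_def products fun_eq_iff algebra_simps)

lemma bracket_gl_0: "lie_bracket (gl scale) 0 0 = 0"
  using bracket_comb[of 0 0 0 0 0 0] by simp

interpretation gl: lie_algebra "gl scale"
  by (rule lie_algebra_gl) unfold_locales

lemma gl_scale: "lie_scale (gl scale) k f = (\<lambda>i. k *s f i)"
  by (simp add: gl_def)

abbreviation "H \<equiv> generated_subalgebra (gl scale) {x, y, z}"
abbreviation "L \<equiv> semidirect_sum H scale"

lemma carrier_gl: "{x, y, z} \<subseteq> lie_carrier (gl scale)"
  by (auto simp: gl_def linear_x linear_y linear_z)

text \<open>By \<open>bracket_comb\<close> the linear span of the generators is already closed under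
  brackets, so generating adds nothing more.\<close>

lemma carrier_H: "lie_carrier H = {comb a b c | a b c. True}"
proof -
  let ?K = "{comb a b c | a b c. True}"
  have "lie_subalgebra (gl scale) ?K"
    unfolding lie_subalgebra_def gl.subspace_def
  proof (intro conjI ballI allI)
    show "0 \<in> ?K" using comb_zero by (metis (mono_tags, lifting) mem_Collect_eq)
    show "?K \<subseteq> lie_carrier (gl scale)" by (auto simp: gl_def linear_comb)
  qed (auto simp: gl_scale comb_add comb_scale bracket_comb; blast)+
  moreover have "{x, y, z} \<subseteq> ?K"
    using comb_gens by (metis (mono_tags, lifting) empty_subsetI insert_subset mem_Collect_eq)
  moreover have "?K \<subseteq> S" if "lie_subalgebra (gl scale) S" "{x, y, z} \<subseteq> S" for S
  proof clarify
    fix a b c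
    have "gl.subspace S" using that by (simp add: lie_subalgebra_def)
    then have "lie_scale (gl scale) a x + lie_scale (gl scale) b y + lie_scale (gl scale) c z \<in> S"
      using that by (intro gl.subspace_add gl.subspace_scale) auto
    also have "lie_scale (gl scale) a x + lie_scale (gl scale) b y + lie_scale (gl scale) c z = comb a b c"
      by (auto simp: gl_scale comb_def)
    finally show "comb a b c \<in> S" .
  qed
  ultimately have "lie_subalgebra (gl scale) hull {x, y, z} = ?K"
    by (intro hull_unique)
  then show ?thesis by (simp add: generated_subalgebra_def)
qed

lemma comb_in_H: "comb a b c \<in> lie_carrier H"
  unfolding carrier_H by blast

lemma gens_in_H: "x \<in> lie_carrier H" "y \<in> lie_carrier H" "z \<in> lie_carrier H"
  and zero_in_H: "0 \<in> lie_carrier H"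
  unfolding carrier_H mem_Collect_eq using comb_gens comb_zero by metis+

lemma H_simps [simp]: "lie_scale H = lie_scale (gl scale)" "lie_bracket H = lie_bracket (gl scale)"
  by (simp_all add: generated_subalgebra_def)

interpretation H: lie_algebra H
  by (rule gl.lie_algebra_generated[OF carrier_gl])

interpretation L: lie_algebra L
  unfolding generated_subalgebra_def
  by (intro lie_algebra_semidirect_sum gl.lie_subalgebra_hull carrier_gl) unfold_locales

lemma heisenberg_H: "heisenberg_lie_algebra H"
proof -
  have lin: "lie_scale H a x + lie_scale H b y + lie_scale H c z = comb a b c" for a b c
    by (auto simp: gl_scale comb_def)
  have "x \<noteq> y" "y \<noteq> z" "x \<noteq> z"
    using comb_eq_iff[of 1 0 0 0 1 0] comb_eq_iff[of 0 1 0 0 0 1] comb_eq_iff[of 1 0 0 0 0 1]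
    by (simp_all add: comb_gens)
  \<comment> \<open>The order \<open>y\<close>, \<open>x\<close>, \<open>z\<close> matches the sign
    in \<open>[y, x] = z\<close>.\<close>
  then have "distinct [y, x, z]" by simp
  moreover have "\<not> H.dependent {y, x, z}"
  proof
    assume "H.dependent {y, x, z}"
    then obtain f where f: "f x \<noteq> 0 \<or> f y \<noteq> 0 \<or> f z \<noteq> 0"
      "(\<Sum>i\<in>{y, x, z}. lie_scale H (f i) i) = 0"
      by (subst (asm) H.dependent_finite) auto
    have "(\<Sum>i\<in>{y, x, z}. lie_scale H (f i) i) = lie_scale H (f x) x + lie_scale H (f y) y + lie_scale H (f z) z"
      using calculation by simp
    then have "comb (f x) (f y) (f z) = 0" using f(2) by (simp only: lin)
    then show False using f(1) comb_eq_0_iff by blast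
  qed
  moreover have "H.span {y, x, z} = lie_carrier H"
  proof
    have "{y, x, z} \<subseteq> lie_carrier H" by (simp add: gens_in_H)
    then show "H.span {y, x, z} \<subseteq> lie_carrier H"
      by (rule H.span_minimal) (rule H.subspace_carrier)
    show "lie_carrier H \<subseteq> H.span {y, x, z}"
      unfolding carrier_H
    proof clarify
      fix a b c
      have "lie_scale H a x + lie_scale H b y + lie_scale H c z \<in> H.span {y, x, z}"
        by (intro H.span_add H.span_scale H.span_base) auto
      then show "comb a b c \<in> H.span {y, x, z}" by (simp only: lin)
    qed
  qed
  moreover have "lie_bracket H y x = z" "lie_bracket H y z = 0" "lie_bracket H x z = 0"
    using bracket_comb[of 0 1 0 1 0 0] bracket_comb[of 0 1 0 0 0 1] bracket_comb[of 1 0 0 0 0 1]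
    by (simp_all add: comb_gens)
  ultimately show ?thesis
    unfolding heisenberg_lie_algebra_def using H.lie_algebra_axioms
    by - (rule conjI, assumption, rule exI[of _ y], rule exI[of _ x], rule exI[of _ z],
      intro conjI; assumption)
qed

section \<open>Derived and lower central series of \<open>L\<close>\<close>

lemma L_simps [simp]:
  "lie_carrier L = lie_carrier H \<times> UNIV"
  "lie_scale L k (h, i) = (\<lambda>i. k *s h i, k *s i)"
  "lie_bracket L (h, i) (h', i') = (lie_bracket (gl scale) h h', h i' - h' i)"
  by (simp_all add: semidirect_sum_def gl_scale)

lemma derived_series_L_Suc_0: "derived_series L (Suc 0) \<subseteq> {(comb 0 0 c, i) | c i. True}"
  unfolding derived_series.simps
proof (rule L.bracket_span_subset)
  show "L.subspace {(comb 0 0 c, i) | c i. True}"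
    unfolding L.subspace_def
  proof (intro conjI ballI allI)
    show "0 \<in> {(comb 0 0 c, i) | c i. True}"
      using comb_zero by (metis (mono_tags, lifting) mem_Collect_eq zero_prod_def)
  qed (auto simp: comb_add comb_scale)
qed (auto simp: carrier_H bracket_comb)

text \<open>Multiples of \<open>z\<close> commute, so the component in \<open>H\<close> dies at this
  stage.\<close>

lemma derived_series_L_2: "derived_series L 2 \<subseteq> {0} \<times> UNIV"
  unfolding numeral_2_eq_2 derived_series.simps(2)[of _ "Suc 0"]
proof (rule L.bracket_span_subset)
  show "L.subspace ({0} \<times> UNIV)"
    unfolding L.subspace_def by (auto simp: zero_prod_def fun_eq_iff)
  fix f g assume "f \<in> derived_series L (Suc 0)" "g \<in> derived_series L (Suc 0)"
  then obtain c i c' i' where "f = (comb 0 0 c, i)" "g = (comb 0 0 c', i')"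
    using derived_series_L_Suc_0 by blast
  then show "lie_bracket L f g \<in> {0} \<times> UNIV" by (simp add: bracket_comb)
qed

lemma derived_series_L_3: "derived_series L 3 = {0}"
proof
  show "derived_series L 3 \<subseteq> {0}"
    unfolding numeral_3_eq_3 derived_series.simps(2)[of _ "Suc (Suc 0)"]
    unfolding numeral_2_eq_2[symmetric]
  proof (rule L.bracket_span_subset)
    fix a b assume "a \<in> derived_series L 2" "b \<in> derived_series L 2"
    then obtain i j where "a = (0, i)" "b = (0, j)" using derived_series_L_2 by blast
    then show "lie_bracket L a b \<in> {0}"
      by (simp add: bracket_gl_0 zero_prod_def)
  qed simp
  show "{0} \<subseteq> derived_series L 3"
    by (simp add: numeral_3_eq_3 bracket_span_def L.span_zero)
qed

lemma derived_series_L_2_nonzero: "derived_series L 2 \<noteq> {0}"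
proof -
  \<comment> \<open>These brackets put \<open>(z, 0)\<close> and \<open>(0, w 0)\<close> into the
    first derived algebra, the latter because \<open>x\<close> carries \<open>w (p - 1)\<close>
    around to \<open>w 0\<close>. Their bracket is \<open>(0, u 1)\<close>.\<close>
  have "lie_bracket L (y, 0) (x, 0) \<in> derived_series L 1"
    "lie_bracket L (x, w (p - 1)) (0, - w (p - 1)) \<in> derived_series L 1"
    "lie_bracket L (x, 0) (0, w (p - 1)) \<in> derived_series L 1"
    unfolding One_nat_def derived_series.simps
    by (intro L.bracket_in_bracket_span; simp add: gens_in_H zero_in_H)+
  moreover have "lie_bracket (gl scale) y x = z" "lie_bracket (gl scale) x 0 = 0"
    using bracket_comb[of 0 1 0 1 0 0] bracket_comb[of 1 0 0 0 0 0]
    by (simp_all add: comb_gens)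
  moreover have "w (Suc (p - 1)) = w 0" using p_gt_1 by simp
  ultimately have "(z, 0) \<in> derived_series L 1" "(0, w 0) \<in> derived_series L 1"
    by simp_all
  then have "lie_bracket L (z, 0) (0, w 0) \<in> derived_series L 2"
    unfolding numeral_2_eq_2 One_nat_def derived_series.simps(2)[of _ "Suc 0"]
    by (rule L.bracket_in_bracket_span)
  moreover have "lie_bracket L (z, 0) (0, w 0) \<noteq> 0"
    using u_nonzero by (simp add: zero_prod_def)
  ultimately show ?thesis by auto
qed

lemma derived_length_L: "derived_length L = 3"
  unfolding derived_length_def
proof (rule Least_equality)
  fix n assume "derived_series L n = {0}"
  then show "3 \<le> n"
    using L.derived_series_zero_mono[of n 2] derived_series_L_2_nonzero by force
qed (rule derived_series_L_3)

lemma not_nilpotent_L: "\<not> lie_nilpotent L"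
proof -
  have "(0, u j) \<in> lower_central_series L n" for n j
  proof (induction n arbitrary: j)
    case 0
    have "(0, u j) \<in> lie_carrier L" using zero_in_H by simp
    then show ?case by (simp only: lower_central_series.simps)
  next
    case (Suc n)
    have "(x, 0) \<in> lie_carrier L" by (simp add: gens_in_H)
    \<comment> \<open>The index \<open>j + (p - 1)\<close> is the cyclic predecessor of
      \<open>j\<close>, written without truncated subtraction.\<close>
    then have "lie_bracket L (x, 0) (0, u (j + (p - 1))) \<in> lower_central_series L (Suc n)"
      unfolding lower_central_series.simps using Suc by (rule L.bracket_in_bracket_span)
    moreover have "u (Suc (j + (p - 1))) = u j" using p_gt_1 by (simp add: u_def)
    moreover have "lie_bracket (gl scale) x 0 = 0"
      using bracket_comb[of 1 0 0 0 0 0] by (simp add: comb_gens)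
    ultimately have "(0, u j) \<in> lower_central_series L (Suc n)" by simp
    then show ?case .
  qed
  then show ?thesis
    using u_nonzero unfolding lie_nilpotent_def zero_prod_def by (metis Pair_inject singletonD)
qed

section \<open>The non-singular derivation\<close>

lemma ex_diagonal:
  fixes b :: 'f
  obtains e where "Vector_Spaces.linear scale scale e"
    and "\<And>j. e (u j) = of_nat j *s u j" and "\<And>j. e (w j) = (of_nat j - b) *s w j"
proof -
  \<comment> \<open>The eigenvalues in the numbering of \<open>v\<close>. Linear extension needs a
    function of the basis vector, so the index is recovered with
    \<open>the_inv_into\<close>.\<close>
  let ?c = "\<lambda>i. if i \<le> p then of_nat (i - 1) else of_nat (i - p - 1) - b"
  obtain e where e: "Vector_Spaces.linear scale scale e"
    "\<And>i. i \<in> {1..2 * p} \<Longrightarrow> e (v i) = ?c i *s v i"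
    using vsp.linear_independent_extend[OF independent_v,
        of "\<lambda>i. ?c (the_inv_into {1..2 * p} v i) *s i"] inj_v
    by (auto simp: the_inv_into_f_f)
  have "e (u j) = of_nat (j mod p) *s u j" "e (w j) = (of_nat (j mod p) - b) *s w j" for j
    using e(2)[of "Suc (j mod p)"] e(2)[of "p + Suc (j mod p)"] p_mod[of j] by (auto simp: u_def w_def)
  then show ?thesis using that e(1) unfolding of_nat_mod_p by metis
qed

text \<open>The first two conditions make \<open>[d, _]\<close> invertible on \<open>H\<close>; the
  last one serves to make \<open>d\<close> reach every \<open>w j\<close>.\<close>

lemma ex_nonsingular_derivation:
  fixes b :: 'f
  assumes b: "b \<noteq> 0" "1 + b \<noteq> 0" "b = 1 \<or> p = 2"
  shows "\<exists>D. nonsingular_derivation L D"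
proof -
  obtain e where linear_e: "Vector_Spaces.linear scale scale e"
    and e_u: "\<And>j. e (u j) = of_nat j *s u j"
    and e_w: "\<And>j. e (w j) = (of_nat j - b) *s w j"
    using ex_diagonal[of b] by blast
  note linear_e_simps = vsp.linear_diff[OF linear_e] vsp.linear_add[OF linear_e]
    vsp.linear_scale[OF linear_e] vsp.linear_0[OF linear_e]
  define d where "d = (\<lambda>i. e i + b *s x i)"
  have linear_d: "Vector_Spaces.linear scale scale d"
    unfolding d_def by (intro vsp.linear_compose_add vsp.linear_compose_scale_right linear_e linear_x)
  note linear_d_simps = vsp.linear_add[OF linear_d] vsp.linear_scale[OF linear_d]
    vsp.linear_diff[OF linear_d]
  \<comment> \<open>Each generator shifts the eigenvalue of \<open>e\<close> by a constant:
    \<open>1\<close> for \<open>x\<close>, \<open>b\<close> from \<open>w j\<close> to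
    \<open>u j\<close>, and \<open>1 + b\<close> from \<open>w j\<close> to
    \<open>u (j + 1)\<close>.\<close>
  have e_xyz: "e (x i) = x (e i) + x i" "e (y i) = y (e i) + b *s y i"
    "e (z i) = z (e i) + (1 + b) *s z i" for i
    by (rule fun_cong[of "\<lambda>i. e (_ i)" "\<lambda>i. _ (e i) + _ i" i], rule linear_ext;
        (rule linearI)?; simp add: e_u e_w linear_e_simps algebra_simps)+
  \<comment> \<open>The term \<open>b x\<close> adds only \<open>[b x, y] = - b z\<close>, so the
    action on \<open>H\<close> is triangular with diagonal \<open>1\<close>, \<open>b\<close>,
    \<open>1 + b\<close>.\<close>
  have bracket_d: "lie_bracket (gl scale) d (comb a1 a2 a3) =
      comb a1 (b * a2) ((1 + b) * a3 - b * a2)" for a1 a2 a3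
    by (auto simp: gl_def comb_def d_def products linear_e_simps e_xyz fun_eq_iff algebra_simps)

  \<comment> \<open>Once a multiple of one vector of a cycle, possibly the zero multiple where \<open>e\<close> vanishes, lies in the
    image of \<open>d\<close>, the term \<open>b x\<close> carries the image around the whole cycle.\<close>
  let ?R = "range d"
  have R: "subspace ?R"
    using vsp.linear_subspace_image[OF linear_d subspace_UNIV] .
  have step: "g (Suc j) \<in> ?R" if "d (g j) = k *s g j + b *s g (Suc j)" "k *s g j \<in> ?R" for g j k
  proof -
    have "d (g j) - k *s g j \<in> ?R" using that(2) by (intro subspace_diff R) auto
    then have "b *s g (Suc j) \<in> ?R" by (simp add: that(1))
    then have "inverse b *s (b *s g (Suc j)) \<in> ?R" by (rule subspace_scale[OF R])
    then show ?thesis using b(1) by simp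
  qed
  have d_u: "d (u j) = of_nat j *s u j + b *s u (Suc j)"
    and d_w: "d (w j) = (of_nat j - b) *s w j + b *s w (Suc j)" for j
    by (simp_all add: d_def e_u e_w)
  have "u (Suc j) \<in> ?R" for j
  proof (induction j)
    case 0
    show ?case by (rule step[of u, OF d_u]) (simp add: subspace_0[OF R])
  next
    case (Suc j)
    show ?case by (rule step[of u, OF d_u]) (rule subspace_scale[OF R Suc])
  qed
  \<comment> \<open>Every residue has a positive representative, so starting at \<open>u 1\<close>
    misses nothing.\<close>
  then have "u j \<in> ?R" for j
    using p_gt_1 by (metis Suc_pred' mod_add_self2 add_Suc_right u_def One_nat_def less_trans zero_less_one)
  moreover have "w j \<in> ?R" for j
    using b(3)
  proof
    assume "b = 1"
    \<comment> \<open>For \<open>b = 1\<close> the eigenvalue \<open>j - b\<close> vanishes at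
      \<open>w 1\<close>, so the induction starts at \<open>w 2\<close>.\<close>
    have "w (Suc (Suc j)) \<in> ?R" for j
    proof (induction j)
      case 0
      show ?case by (rule step[of w, OF d_w]) (simp add: \<open>b = 1\<close> subspace_0[OF R])
    next
      case (Suc j)
      show ?case by (rule step[of w, OF d_w]) (rule subspace_scale[OF R Suc])
    qed
    then have "w (Suc (Suc (j + (p - 2)))) \<in> ?R" .
    also have "Suc (Suc (j + (p - 2))) = j + p" using p_gt_1 by simp
    also have "w (j + p) = w j" by (simp add: w_def)
    finally show ?thesis .
  next
    assume "p = 2"
    have w2: "w 2 = w 0" using w_p \<open>p = 2\<close> by simp
    \<comment> \<open>Here \<open>e\<close> may have no zero eigenvalue on the \<open>w\<close>
      half; instead \<open>- b w 0 + b w 1\<close> and \<open>(1 - b) w 1 + b w 0\<close> sum to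
      \<open>w 1\<close>.\<close>
    have "d (w 0) + d (w 1) = w 1"
      by (simp add: d_w w2 numeral_2_eq_2[symmetric] algebra_simps)
    then have w1: "w 1 \<in> ?R" by (metis subspace_add[OF R] rangeI)
    then have "w (Suc 1) \<in> ?R" by (intro step[of w, OF d_w] subspace_scale[OF R])
    then have "w 0 \<in> ?R" using w2 by (simp add: numeral_2_eq_2)
    moreover have "j mod p = 0 \<or> j mod p = 1" using \<open>p = 2\<close> by auto
    moreover have "w j = w (j mod p)" by (simp add: w_def)
    ultimately show ?thesis using w1 by metis
  qed
  ultimately have "span (range u \<union> range w) \<subseteq> ?R"
    by (intro span_minimal R) auto
  then have "surj d" by (auto simp: span_uw)
  then have "bij d" using linear_surj_imp_inj[OF linear_d] by (simp add: bij_def)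

  have "bij_betw (lie_bracket (gl scale) d) (lie_carrier H) (lie_carrier H)"
    unfolding bij_betw_def
  proof (intro conjI subset_antisym)
    show "inj_on (lie_bracket (gl scale) d) (lie_carrier H)"
      using b by (auto simp: inj_on_def carrier_H bracket_d comb_eq_iff)
    show "lie_bracket (gl scale) d ` lie_carrier H \<subseteq> lie_carrier H"
    proof (rule image_subsetI)
      fix h assume "h \<in> lie_carrier H"
      then obtain a1 a2 a3 where "h = comb a1 a2 a3" unfolding carrier_H by blast
      then show "lie_bracket (gl scale) d h \<in> lie_carrier H" by (simp add: bracket_d comb_in_H)
    qed
    show "lie_carrier H \<subseteq> lie_bracket (gl scale) d ` lie_carrier H"
    proof
      fix h assume "h \<in> lie_carrier H"
      then obtain a1 a2 a3 where "h = comb a1 a2 a3" unfolding carrier_H by blast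
      \<comment> \<open>Back substitution in the triangular system: the second coordinate
        contributes \<open>- a2\<close> to the third, hence the numerator
        \<open>a3 + a2\<close>.\<close>
      then have "h = lie_bracket (gl scale) d (comb a1 (a2 / b) ((a3 + a2) / (1 + b)))"
        using b by (simp add: bracket_d)
      then show "h \<in> lie_bracket (gl scale) d ` lie_carrier H"
        using comb_in_H by blast
    qed
  qed
  with \<open>bij d\<close> have "bij_betw (map_prod (lie_bracket (gl scale) d) d) (lie_carrier L) (lie_carrier L)"
    unfolding L_simps by (rule bij_betw_map_prod[rotated])
  moreover have "lie_derivation L (map_prod (lie_bracket (gl scale) d) d)"
  proof -
    have "lie_carrier H \<subseteq> lie_carrier (gl scale)"
      unfolding carrier_H by (auto simp: gl_def linear_comb)
    note H_gl = subsetD[OF this]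
    have d_gl: "d \<in> lie_carrier (gl scale)" by (simp add: gl_def linear_d)
    \<comment> \<open>This is the Jacobi identity in \<open>gl scale\<close>. On the module
      component the product rule is \<open>d (f i) = [d, f] i + f (d i)\<close>, the definition of
      the commutator.\<close>
    have "lie_bracket (gl scale) d (lie_bracket (gl scale) f g) =
      lie_bracket (gl scale) (lie_bracket (gl scale) d f) g +
      lie_bracket (gl scale) f (lie_bracket (gl scale) d g)"
      if "f \<in> lie_carrier H" "g \<in> lie_carrier H" for f g
      using that[THEN H_gl] d_gl
      by (auto simp: gl_def fun_eq_iff vsp.linear_diff)
    moreover have "lie_bracket (gl scale) d f \<in> lie_carrier H" if "f \<in> lie_carrier H" for f
    proof -
      from that obtain a1 a2 a3 where "f = comb a1 a2 a3" unfolding carrier_H by blast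
      then show ?thesis by (simp add: bracket_d comb_in_H)
    qed
    moreover have "lie_bracket (gl scale) f g i = f (g i) - g (f i)" for f g i
      by (simp add: gl_def)
    moreover have "lie_bracket (gl scale) d (\<lambda>i. k *s f i) = (\<lambda>i. k *s lie_bracket (gl scale) d f i)" for k f
      by (auto simp: gl_def linear_d_simps algebra_simps)
    ultimately show ?thesis
      using gl.bracket_add_right[OF d_gl H_gl H_gl]
      unfolding lie_derivation_def L_simps
      by (auto simp: linear_d_simps)
  qed
  ultimately show ?thesis unfolding nonsingular_derivation_def by blast
qed

text \<open>For \<open>p = 2\<close> the field is infinite or has at least four elements, so it
  exceeds \<open>{0, - 1}\<close>. For odd \<open>p\<close>, \<open>b = 1\<close> works since
  \<open>2\<close> is nonzero.\<close>

lemma ex_parameter: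
  assumes "infinite (UNIV :: 'f set) \<or> card (UNIV :: 'f set) \<ge> p\<^sup>2"
  shows "\<exists>b :: 'f. b \<noteq> 0 \<and> 1 + b \<noteq> 0 \<and> (b = 1 \<or> p = 2)"
proof (cases "p = 2")
  case True
  have "\<not> UNIV \<subseteq> {0, - 1 :: 'f}"
  proof
    assume "UNIV \<subseteq> {0, - 1 :: 'f}"
    moreover from this have "finite (UNIV :: 'f set)"
      by (rule finite_subset) simp
    ultimately have "finite (UNIV :: 'f set)" "card (UNIV :: 'f set) \<le> card {0, - 1 :: 'f}"
      by (auto intro!: card_mono simp del: card_insert_disjoint)
    moreover have "card {0, - 1 :: 'f} \<le> 2"
      using card_insert_le_m1[of 2 "{- 1 :: 'f}" 0] by simp
    ultimately have "card (UNIV :: 'f set) \<le> 2" by linarith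
    then show False using assms True \<open>finite UNIV\<close> by simp
  qed
  then show ?thesis using True by (auto simp: add_eq_0_iff)
next
  case False
  have "(of_nat 2 :: 'f) \<noteq> 0"
    unfolding of_nat_eq_0_iff_char_dvd CHAR_p using False prime_p two_is_prime_nat primes_dvd_imp_eq by blast
  then show ?thesis by (intro exI[of _ 1]) simp
qed

end

theorem proposition3p2:
  fixes scale :: "'f::field \<Rightarrow> 'v::ab_group_add \<Rightarrow> 'v"
    and p :: nat
    and v :: "nat \<Rightarrow> 'v"
    and x y z :: "'v \<Rightarrow> 'v"
    and H :: "('f, 'v \<Rightarrow> 'v) lie"
    and L :: "('f, ('v \<Rightarrow> 'v) \<times> 'v) lie"
  assumes "prime p" and "CHAR('f) = p"
    and "vector_space scale"
    and "inj_on v {1..2 * p}"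
    and "\<not> module.dependent scale (v ` {1..2 * p})"
    and "module.span scale (v ` {1..2 * p}) = UNIV"
    and "Vector_Spaces.linear scale scale x"
    and "\<And>i. i \<in> {1..p - 1} \<Longrightarrow> x (v i) = v (i + 1)"
    and "x (v p) = v 1"
    and "\<And>i. i \<in> {1..p - 1} \<Longrightarrow> x (v (p + i)) = v (p + i + 1)"
    and "x (v (2 * p)) = v (p + 1)"
    and "Vector_Spaces.linear scale scale y"
    and "\<And>i. i \<in> {1..p} \<Longrightarrow> y (v i) = 0"
    and "y (v (p + 1)) = 0"
    and "\<And>i. i \<in> {2..p} \<Longrightarrow> y (v (p + i)) = scale (of_nat (i - 1)) (v i)"
    and "Vector_Spaces.linear scale scale z"
    and "\<And>i. i \<in> {1..p} \<Longrightarrow> z (v i) = 0"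
    and "\<And>i. i \<in> {1..p - 1} \<Longrightarrow> z (v (p + i)) = v (i + 1)"
    and "z (v (2 * p)) = v 1"
  defines "H \<equiv> generated_subalgebra (gl scale) {x, y, z}"
  defines "L \<equiv> semidirect_sum H scale"
  shows "heisenberg_lie_algebra H \<and>
    lie_solvable L \<and> derived_length L = 3 \<and> \<not> lie_nilpotent L \<and>
    (infinite (UNIV :: 'f set) \<or> card (UNIV :: 'f set) \<ge> p\<^sup>2 \<longrightarrow>
      (\<exists>D. nonsingular_derivation L D))"
proof -
  interpret heisenberg_module scale p v x y z
    using assms(1-19) by (intro heisenberg_module.intro heisenberg_module_axioms.intro)
  have "lie_solvable L"
    unfolding lie_solvable_def L_def H_def using derived_series_L_3 by blast
  then show ?thesis
    using heisenberg_H derived_length_L not_nilpotent_L ex_parameter ex_nonsingular_derivation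
    unfolding L_def H_def by blast
qed

end
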